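(* Let $d,k\ge 2$ be integers. For every $p\in(0,d^{-1})$ we have $q_c(p) > (1-dp)/d^k$.
   Context: Let $[d]=\{1,\dots,d\}$ and $V=\bigcup_{n\ge 0}[d]^n$, where $[d]^0=\{o\}$ ($o$ is the root, the empty sequence); $u\cdot v$ denotes concatenation of sequences, with $o\cdot v=v\cdot o=v$. Let $\mathbb{T}=\mathbb{T}_{d,k}=(V,E)$ be the oriented graph with $E=E_s\cup E_\ell$, where $E_s=\{\langle r,r\cdot i\rangle: r\in V,\ i\in[d]\}$ (short edges) and $E_\ell=\{\langle r,r\cdot i\rangle: r\in V,\ i\in[d]^k\}$ (long edges). Under $\mathbb{P}_{p,q}$, all edges are independent, each short edge is open with probability $p$ and each long edge is open with probability $q$. The cluster of the root $\mathscr{C}_{p,q}$ is the set of vertices that can be reached from $o$ by an oriented open path (including $o$). Define $q_c(p)=\inf\{q\in[0,1]:\ \mathbb{P}(|\mathscr{C}_{p,q}|=\infty)>0\}$ (which depends also on $d,k$). *)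

theory Defs
  imports "HOL-Probability.Probability"
begin

type_synonym vertex = "nat list"
type_synonym edge = "vertex \<times> vertex"

text \<open>The set $[d]^n$ of words of length $n$ over $[d] = \{1,\dots,d\}$; the root is the empty
  word, and concatenation of words is list append.\<close>

definition words :: "nat \<Rightarrow> nat \<Rightarrow> vertex set" where
  "words d n = {v. length v = n \<and> set v \<subseteq> {1..d}}"

definition vertices :: "nat \<Rightarrow> vertex set" where
  "vertices d = (\<Union>n. words d n)"

definition short_edges :: "nat \<Rightarrow> edge set" where
  "short_edges d = {(r, r @ [i]) | r i. r \<in> vertices d \<and> i \<in> {1..d}}"

definition long_edges :: "nat \<Rightarrow> nat \<Rightarrow> edge set" where
  "long_edges d k = {(r, r @ w) | r w. r \<in> vertices d \<and> w \<in> words d k}"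

definition edges :: "nat \<Rightarrow> nat \<Rightarrow> edge set" where
  "edges d k = short_edges d \<union> long_edges d k"

text \<open>The law $\mathbb{P}_{p,q}$ of the configuration of open edges (\<open>\<omega> e\<close> means that \<open>e\<close> is open).
  For $k \ge 2$ short and long edges are disjoint, so the case distinction is unambiguous.
  Only parameters in $[0,1]$ are meaningful.\<close>

definition percolation :: "nat \<Rightarrow> nat \<Rightarrow> real \<Rightarrow> real \<Rightarrow> (edge \<Rightarrow> bool) measure" where
  "percolation d k p q =
     (\<Pi>\<^sub>M e\<in>edges d k. measure_pmf (bernoulli_pmf (if e \<in> short_edges d then p else q)))"

definition root_cluster :: "nat \<Rightarrow> nat \<Rightarrow> (edge \<Rightarrow> bool) \<Rightarrow> vertex set" where
  "root_cluster d k \<omega> = {v. ([], v) \<in> {e \<in> edges d k. \<omega> e}\<^sup>*}"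

definition critical_q :: "nat \<Rightarrow> nat \<Rightarrow> real \<Rightarrow> real" where
  "critical_q d k p =
     Inf {q \<in> {0..1}. \<P>(\<omega> in percolation d k p q. infinite (root_cluster d k \<omega>)) > 0}"

end

theory Submission
  imports Defs
begin

text \<open>A step of a path appends a word of length \<open>1\<close> or \<open>k\<close>, so the expected number of open paths
  with \<open>n\<close> steps from the root is \<open>(d p + d\<^sup>k q)\<^sup>n\<close>. This first-moment count alone gives no more than
  \<open>q\<^sub>c \<ge> q\<^sub>0\<close>, where \<open>q\<^sub>0 = (1 - d p) / d\<^sup>k\<close> is the value at which the base equals \<open>1\<close>. It overcounts,
  because a vertex may be reached both by \<open>k\<close> consecutive short edges and by the one long edge that
  bridges them, and this is what makes the inequality strict.

  It suffices to count paths that reach their endpoint with the fewest steps. Such a path never takes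
  \<open>k\<close> consecutive short edges whose bridging long edge is open (\<open>shortest_path_constraints\<close>).
  Cut its first \<open>k j\<close> steps into \<open>j\<close> blocks of \<open>k\<close> steps. The steps of a block contribute
  \<open>(d p + d\<^sup>k q)\<^sup>k\<close> to the expectation, and in the all-short blocks, whose share is \<open>(d p)\<^sup>k\<close>, the
  closed bridge contributes a further factor \<open>1 - q\<close>. All edges involved are distinct, hence
  independent, and the expected number of sequences of \<open>j\<close> blocks that meet these conditions is \<open>f(q)\<^sup>j\<close> with
  \<open>f(q) = (d p + d\<^sup>k q)\<^sup>k - q (d p)\<^sup>k\<close>.

  An infinite cluster contains vertices at arbitrarily large distance, so its probability is at most
  \<open>f(q)\<^sup>j\<close> for every \<open>j\<close> (\<open>prob_infinite_cluster_le\<close>) and vanishes when \<open>f(q) < 1\<close>. Now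
  \<open>f(q\<^sub>0) = 1 - q\<^sub>0 (d p)\<^sup>k < 1\<close>, and by continuity \<open>f < 1\<close> also slightly beyond \<open>q\<^sub>0\<close>.

  Since \<open>q\<^sub>c\<close> is an infimum of real numbers, one also has to know that the set of supercritical \<open>q\<close> is
  nonempty; it contains \<open>1\<close> (\<open>prob_infinite_cluster_1\<close>), which in turn needs the measurability of the
  event that the cluster is infinite.\<close>

section \<open>Open paths as lists of steps\<close>

definition steps :: "nat \<Rightarrow> nat \<Rightarrow> vertex set" where
  "steps d k = words d 1 \<union> words d k"

fun path_edges :: "vertex \<Rightarrow> vertex list \<Rightarrow> edge list" where
  "path_edges r [] = []"
| "path_edges r (s # ss) = (r, r @ s) # path_edges (r @ s) ss"

abbreviation open_graph :: "nat \<Rightarrow> nat \<Rightarrow> (edge \<Rightarrow> bool) \<Rightarrow> edge set" where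
  "open_graph d k \<omega> \<equiv> {e \<in> edges d k. \<omega> e}"

lemma words_eq_lists: "words d n = {v. set v \<subseteq> {1..d} \<and> length v = n}"
  by (auto simp: words_def)

lemma finite_words [simp]: "finite (words d n)"
  unfolding words_eq_lists by (rule finite_lists_length_eq) simp

lemma card_words: "card (words d n) = d ^ n"
  unfolding words_eq_lists by (subst card_lists_length_eq) simp_all

lemma finite_steps [simp]: "finite (steps d k)"
  by (simp add: steps_def)

lemma in_vertices_iff: "v \<in> vertices d \<longleftrightarrow> set v \<subseteq> {1..d}"
  by (auto simp: vertices_def words_def)

lemma length_step:
  assumes "s \<in> steps d k" "k \<ge> 2"
  shows "1 \<le> length s" "length s \<le> k"
  using assms by (auto simp: steps_def words_def)

lemma append_step_in_vertices:
  "r \<in> vertices d \<Longrightarrow> s \<in> steps d k \<Longrightarrow> r @ s \<in> vertices d"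
  by (auto simp: in_vertices_iff steps_def words_def)

lemma append_concat_in_vertices:
  "r \<in> vertices d \<Longrightarrow> set ss \<subseteq> steps d k \<Longrightarrow> r @ concat ss \<in> vertices d"
  by (induction ss arbitrary: r) (auto simp: in_vertices_iff steps_def words_def)

lemma edges_eq: "edges d k = {(r, r @ s) | r s. r \<in> vertices d \<and> s \<in> steps d k}"
proof -
  have "words d 1 = {[i] | i. i \<in> {1..d}}"
    by (auto simp: words_def length_Suc_conv)
  then have "short_edges d = {(r, r @ s) | r s. r \<in> vertices d \<and> s \<in> words d 1}"
    unfolding short_edges_def by auto
  then show ?thesis
    unfolding edges_def long_edges_def steps_def by blast
qed

lemma step_edge_in_edges: "r \<in> vertices d \<Longrightarrow> s \<in> steps d k \<Longrightarrow> (r, r @ s) \<in> edges d k"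
  by (auto simp: edges_eq)

lemma short_edge_iff:
  assumes "r \<in> vertices d" "s \<in> steps d k"
  shows "(r, r @ s) \<in> short_edges d \<longleftrightarrow> length s = 1"
  using assms by (auto simp: short_edges_def steps_def words_def length_Suc_conv)

lemma path_edges_in_edges:
  "r \<in> vertices d \<Longrightarrow> set ss \<subseteq> steps d k \<Longrightarrow> set (path_edges r ss) \<subseteq> edges d k"
proof (induction ss arbitrary: r)
  case (Cons s ss)
  then have "set (path_edges (r @ s) ss) \<subseteq> edges d k"
    by (intro Cons.IH append_step_in_vertices) auto
  with Cons.prems show ?case by (simp add: step_edge_in_edges)
qed simp

text \<open>The starting points of the edges of a path get strictly longer. This separates edges of the same
  path, and edges of consecutive blocks, from each other.\<close>

lemma fst_path_edges_bounds:
  assumes "e \<in> set (path_edges r ss)" "\<forall>s\<in>set ss. s \<noteq> []"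
  shows "length r \<le> length (fst e)" "length (fst e) < length r + length (concat ss)"
proof -
  have "length r \<le> length (fst e) \<and> length (fst e) < length r + length (concat ss)"
    using assms
  proof (induction ss arbitrary: r)
    case (Cons s ss)
    then have "0 < length s" by simp
    show ?case
    proof (cases "e = (r, r @ s)")
      case False
      then have "e \<in> set (path_edges (r @ s) ss)" using Cons.prems(1) by simp
      from Cons.IH[OF this] Cons.prems(2) show ?thesis by simp
    qed (use \<open>0 < length s\<close> in simp)
  qed simp
  then show "length r \<le> length (fst e)" "length (fst e) < length r + length (concat ss)"
    by simp_all
qed

lemma distinct_path_edges: "\<forall>s\<in>set ss. s \<noteq> [] \<Longrightarrow> distinct (path_edges r ss)"
proof (induction ss arbitrary: r)
  case (Cons s ss)
  then have "(r, r @ s) \<notin> set (path_edges (r @ s) ss)"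
    using fst_path_edges_bounds(1)[of "(r, r @ s)" "r @ s" ss] by auto
  with Cons show ?case by simp
qed simp

lemma path_edges_step:
  "(u, v) \<in> set (path_edges r ss) \<Longrightarrow> \<exists>s\<in>set ss. v = u @ s"
  by (induction ss arbitrary: r) auto

lemma length_concat_le: "\<forall>s\<in>set ss. length s \<le> k \<Longrightarrow> length (concat ss) \<le> k * length ss"
proof (induction ss)
  case (Cons s ss)
  then have "length (concat ss) \<le> k * length ss" "length s \<le> k" by simp_all
  then show ?case by (simp del: length_concat)
qed simp

lemma length_concat_ge: "\<forall>s\<in>set ss. 1 \<le> length s \<Longrightarrow> length ss \<le> length (concat ss)"
proof (induction ss)
  case (Cons s ss)
  then have "length ss \<le> length (concat ss)" "1 \<le> length s" by simp_all
  then show ?case unfolding concat.simps length_append list.size by linarith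
qed simp

lemma length_concat_eq: "\<forall>s\<in>set ss. length s = 1 \<Longrightarrow> length (concat ss) = length ss"
proof (induction ss)
  case (Cons s ss)
  then have "length (concat ss) = length ss" "length s = 1" by simp_all
  then show ?case unfolding concat.simps length_append list.size by linarith
qed simp

lemma relpow_imp_path:
  assumes "(r, v) \<in> open_graph d k \<omega> ^^ n"
  shows "\<exists>ss. length ss = n \<and> set ss \<subseteq> steps d k \<and> v = r @ concat ss
           \<and> (\<forall>e\<in>set (path_edges r ss). \<omega> e)"
  using assms
proof (induction n arbitrary: r)
  case (Suc n)
  from relpow_Suc_D2[OF Suc.prems] obtain u
    where u: "(r, u) \<in> open_graph d k \<omega>" "(u, v) \<in> open_graph d k \<omega> ^^ n" by blast
  then obtain s where "s \<in> steps d k" "u = r @ s" "\<omega> (r, r @ s)"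
    by (auto simp: edges_eq)
  moreover from Suc.IH[OF u(2)] obtain ss where "length ss = n" "set ss \<subseteq> steps d k"
    "v = u @ concat ss" "\<forall>e\<in>set (path_edges u ss). \<omega> e" by blast
  ultimately show ?case by (intro exI[of _ "s # ss"]) auto
qed simp

lemma path_imp_rtrancl:
  assumes "r \<in> vertices d" "set ss \<subseteq> steps d k" "\<forall>e\<in>set (path_edges r ss). \<omega> e"
  shows "(r, r @ concat ss) \<in> (open_graph d k \<omega>)\<^sup>*"
  using assms
proof (induction ss arbitrary: r)
  case (Cons s ss)
  have "(r @ s, (r @ s) @ concat ss) \<in> (open_graph d k \<omega>)\<^sup>*"
    using Cons by (intro Cons.IH) (auto intro: append_step_in_vertices)
  moreover have "(r, r @ s) \<in> open_graph d k \<omega>"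
    using Cons.prems by (auto intro: step_edge_in_edges)
  ultimately show ?case by (simp add: converse_rtrancl_into_rtrancl)
qed simp

text \<open>Within \<open>n\<close> steps only words of length at most \<open>k n\<close> are reached, and there are finitely
  many of these.\<close>

lemma infinite_cluster_far_vertex:
  assumes "k \<ge> 2" "infinite (root_cluster d k \<omega>)"
  obtains v where "v \<in> root_cluster d k \<omega>"
    "\<And>m. ([], v) \<in> open_graph d k \<omega> ^^ m \<Longrightarrow> n \<le> m"
proof -
  let ?F = "{v. set v \<subseteq> {1..d} \<and> length v \<le> k * n}"
  have "finite ?F" by (rule finite_lists_length_le) simp
  with assms(2) have "\<not> root_cluster d k \<omega> \<subseteq> ?F" using finite_subset by blast
  then obtain v where v: "v \<in> root_cluster d k \<omega>" "v \<notin> ?F" by blast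
  show ?thesis
  proof (rule that[OF v(1)])
    fix m assume "([], v) \<in> open_graph d k \<omega> ^^ m"
    from relpow_imp_path[OF this] obtain ss
      where ss: "length ss = m" "set ss \<subseteq> steps d k" "v = concat ss" by auto
    have "v \<in> vertices d"
      using append_concat_in_vertices[of "[]" d ss k] ss by (auto simp: in_vertices_iff)
    with v(2) have "k * n < length v" by (auto simp: in_vertices_iff)
    also have "length (concat ss) \<le> k * length ss"
      using ss(2) length_step(2)[OF _ assms(1)] by (intro length_concat_le) blast
    then have "length v \<le> k * m" using ss by simp
    finally show "n \<le> m" by simp
  qed
qed

text \<open>This reformulation has only countable quantifiers over events that depend on finitely many
  edges, which makes the event measurable.\<close>

lemma infinite_cluster_iff:
  assumes "k \<ge> 2"
  shows "infinite (root_cluster d k \<omega>) \<longleftrightarrow>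
    (\<forall>n. \<exists>ss\<in>{ss. set ss \<subseteq> steps d k \<and> length ss = n}. \<forall>e\<in>set (path_edges [] ss). \<omega> e)"
  (is "?L \<longleftrightarrow> ?R")
proof
  assume ?L
  show ?R
  proof
    fix n
    obtain v where v: "v \<in> root_cluster d k \<omega>"
      "\<And>m. ([], v) \<in> open_graph d k \<omega> ^^ m \<Longrightarrow> n \<le> m"
      using infinite_cluster_far_vertex[OF assms \<open>?L\<close>] by blast
    from v(1) obtain m where m: "([], v) \<in> open_graph d k \<omega> ^^ m"
      by (auto simp: root_cluster_def rtrancl_power)
    then obtain m' where "m = n + m'" using v(2) le_Suc_ex by blast
    with m obtain u where "([], u) \<in> open_graph d k \<omega> ^^ n"
      by (auto simp: relpow_add)
    from relpow_imp_path[OF this]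
    show "\<exists>ss\<in>{ss. set ss \<subseteq> steps d k \<and> length ss = n}. \<forall>e\<in>set (path_edges [] ss). \<omega> e"
      by auto
  qed
next
  assume ?R
  show ?L
  proof
    assume fin: "finite (root_cluster d k \<omega>)"
    define n where "n = Suc (Max (length ` root_cluster d k \<omega>))"
    from \<open>?R\<close> obtain ss where ss: "set ss \<subseteq> steps d k" "length ss = n"
      "\<forall>e\<in>set (path_edges [] ss). \<omega> e" by blast
    have "concat ss \<in> root_cluster d k \<omega>"
      using path_imp_rtrancl[of "[]" d ss k \<omega>] ss
      by (auto simp: root_cluster_def in_vertices_iff)
    then have "length (concat ss) < n"
      using fin by (simp add: n_def less_Suc_eq_le)
    moreover have "n \<le> length (concat ss)"
      unfolding ss(2)[symmetric] using ss(1) length_step(1)[OF _ assms]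
      by (intro length_concat_ge) blast
    ultimately show False by simp
  qed
qed

section \<open>Paths without shortcuts\<close>

definition blocks :: "nat \<Rightarrow> nat \<Rightarrow> vertex list set" where
  "blocks d k = {b. set b \<subseteq> steps d k \<and> length b = k}"

text \<open>A constraint \<open>(e, x)\<close> demands that the edge \<open>e\<close> has state \<open>x\<close>. The closed edge of an all-short
  block is the bridge that would replace its \<open>k\<close> steps.\<close>

definition block_constraints :: "vertex \<Rightarrow> vertex list \<Rightarrow> (edge \<times> bool) list" where
  "block_constraints r b =
     map (\<lambda>e. (e, True)) (path_edges r b) @
     (if \<forall>s\<in>set b. length s = 1 then [((r, r @ concat b), False)] else [])"

fun constraints :: "vertex \<Rightarrow> vertex list list \<Rightarrow> (edge \<times> bool) list" where
  "constraints r [] = []"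
| "constraints r (b # bs) = block_constraints r b @ constraints (r @ concat b) bs"

lemma finite_blocks [simp]: "finite (blocks d k)"
  unfolding blocks_def by (rule finite_lists_length_eq) simp

lemma block_steps_nonempty:
  "b \<in> blocks d k \<Longrightarrow> k \<ge> 2 \<Longrightarrow> s \<in> set b \<Longrightarrow> s \<noteq> []"
  using length_step(1)[of s d k] by (auto simp: blocks_def)

lemma short_block_concat:
  assumes "b \<in> blocks d k" "\<forall>s\<in>set b. length s = 1"
  shows "concat b \<in> words d k"
proof -
  have "length b = k" "set b \<subseteq> steps d k" using assms(1) by (auto simp: blocks_def)
  moreover from this(2) have "set (concat b) \<subseteq> {1..d}"
    by (fastforce simp: steps_def words_def)
  ultimately show ?thesis
    using length_concat_eq[OF assms(2)] by (simp add: words_def)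
qed

text \<open>If a block of \<open>k\<close> short steps on a path from \<open>r\<close> to \<open>v\<close> were bridged by an open long edge,
  then taking that edge would save \<open>k - 1 > 0\<close> steps. Minimality passes to the part of the
  path after the first block, so one may go on block by block.\<close>

lemma shortest_path_constraints:
  assumes "k \<ge> 2" "r \<in> vertices d"
    and "(r, v) \<in> open_graph d k \<omega> ^^ m" "k * j \<le> m"
    and "\<And>m'. (r, v) \<in> open_graph d k \<omega> ^^ m' \<Longrightarrow> m \<le> m'"
  shows "\<exists>bs. set bs \<subseteq> blocks d k \<and> length bs = j \<and> (\<forall>(e, x)\<in>set (constraints r bs). \<omega> e = x)"
  using assms(2-)
proof (induction j arbitrary: r m)
  case (Suc j)
  let ?G = "open_graph d k \<omega>"
  from Suc.prems(3) obtain m1 where m1: "m = k + m1" "k * j \<le> m1"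
    using that[of "m - k"] by simp
  with Suc.prems(2) obtain u where u: "(r, u) \<in> ?G ^^ k" "(u, v) \<in> ?G ^^ m1"
    by (auto simp: relpow_add)
  from relpow_imp_path[OF u(1)] obtain b where b: "length b = k" "set b \<subseteq> steps d k"
    "u = r @ concat b" "\<forall>e\<in>set (path_edges r b). \<omega> e" by blast
  then have bb: "b \<in> blocks d k" by (simp add: blocks_def)
  have uV: "u \<in> vertices d" using b Suc.prems(1) append_concat_in_vertices by blast
  have min: "m1 \<le> m'" if "(u, v) \<in> ?G ^^ m'" for m'
  proof -
    have "(r, v) \<in> ?G ^^ (k + m')" using u(1) that by (auto simp: relpow_add)
    from Suc.prems(4)[OF this] show ?thesis using m1 by simp
  qed
  obtain bs where bs: "set bs \<subseteq> blocks d k" "length bs = j"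
    "\<forall>(e, x)\<in>set (constraints u bs). \<omega> e = x"
    using Suc.IH[OF uV u(2) m1(2) min] by blast
  have "\<not> \<omega> (r, r @ concat b)" if "\<forall>s\<in>set b. length s = 1"
  proof
    assume "\<omega> (r, r @ concat b)"
    moreover have "concat b \<in> steps d k"
      using short_block_concat[OF bb that] by (simp add: steps_def)
    ultimately have "(r, u) \<in> ?G"
      using step_edge_in_edges[OF Suc.prems(1)] by (simp add: b(3))
    then have "(r, v) \<in> ?G ^^ Suc m1" using u(2) by (rule relpow_Suc_I2)
    from Suc.prems(4)[OF this] m1 assms(1) show False by simp
  qed
  then have "\<forall>(e, x)\<in>set (block_constraints r b). \<omega> e = x"
    using b(4) by (auto simp: block_constraints_def)
  with bs b(3) bb show ?case
    by (intro exI[of _ "b # bs"]) auto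
qed simp

text \<open>An infinite cluster has vertices at distance at least \<open>k j\<close> from the root; the first \<open>j\<close> blocks of
  a shortest path to one of them will do.\<close>

lemma infinite_cluster_constraints:
  assumes "k \<ge> 2" "infinite (root_cluster d k \<omega>)"
  shows "\<exists>bs\<in>{bs. set bs \<subseteq> blocks d k \<and> length bs = j}.
           \<forall>(e, x)\<in>set (constraints [] bs). \<omega> e = x"
proof -
  obtain v where v: "v \<in> root_cluster d k \<omega>"
    "\<And>m. ([], v) \<in> open_graph d k \<omega> ^^ m \<Longrightarrow> k * j \<le> m"
    using infinite_cluster_far_vertex[OF assms] by blast
  define m where "m = (LEAST m. ([], v) \<in> open_graph d k \<omega> ^^ m)"
  from v(1) have "\<exists>m. ([], v) \<in> open_graph d k \<omega> ^^ m"
    by (auto simp: root_cluster_def rtrancl_power)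
  then have m: "([], v) \<in> open_graph d k \<omega> ^^ m" unfolding m_def by (rule LeastI_ex)
  have "m \<le> m'" if "([], v) \<in> open_graph d k \<omega> ^^ m'" for m'
    unfolding m_def using that by (rule Least_le)
  from shortest_path_constraints[OF assms(1) _ m v(2)[OF m] this]
  show ?thesis by (auto simp: in_vertices_iff)
qed

section \<open>Probabilities of cylinder events\<close>

abbreviation edge_prob :: "nat \<Rightarrow> real \<Rightarrow> real \<Rightarrow> edge \<Rightarrow> real" where
  "edge_prob d p q e \<equiv> if e \<in> short_edges d then p else q"

lemma prob_space_percolation: "prob_space (percolation d k p q)"
  unfolding percolation_def by (intro prob_space_PiM measure_pmf.prob_space_axioms)

lemma cylinder_eq_prod_emb:
  assumes "J \<subseteq> I"
  shows "{\<omega> \<in> space (Pi\<^sub>M I M). \<forall>i\<in>J. \<omega> i \<in> X i} = prod_emb I M J (Pi\<^sub>E J X)"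
  unfolding prod_emb_def using assms by (auto simp: space_PiM Pi_iff)

text \<open>Distinctness of the edges makes their states independent, so the probabilities multiply.\<close>

lemma
  assumes "distinct (map fst cs)" "fst ` set cs \<subseteq> edges d k"
  shows cylinder_in_sets: "{\<omega> \<in> space (percolation d k p q). \<forall>(e, x)\<in>set cs. \<omega> e = x}
            \<in> sets (percolation d k p q)" (is "?S \<in> _")
    and measure_cylinder: "measure (percolation d k p q)
           {\<omega> \<in> space (percolation d k p q). \<forall>(e, x)\<in>set cs. \<omega> e = x} =
         prod_list (map (\<lambda>(e, x). pmf (bernoulli_pmf (edge_prob d p q e)) x) cs)"
proof -
  interpret product_prob_space "\<lambda>e. measure_pmf (bernoulli_pmf (edge_prob d p q e))" "edges d k"
    by unfold_locales
  let ?J = "set (map fst cs)"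
  let ?X = "\<lambda>e. {the (map_of cs e)}"
  have mo: "the (map_of cs e) = x" if "(e, x) \<in> set cs" for e x
    using map_of_is_SomeI[OF assms(1) that] by simp
  have J: "?J \<subseteq> edges d k" "finite ?J" using assms(2) by auto
  have "(\<forall>(e, x)\<in>set cs. \<omega> e = x) \<longleftrightarrow> (\<forall>e\<in>?J. \<omega> e \<in> ?X e)" for \<omega>
    by (force simp: mo)
  then have "?S = {\<omega> \<in> space (percolation d k p q). \<forall>e\<in>?J. \<omega> e \<in> ?X e}"
    by (simp only:)
  also have "\<dots> = prod_emb (edges d k)
      (\<lambda>e. measure_pmf (bernoulli_pmf (edge_prob d p q e))) ?J (Pi\<^sub>E ?J ?X)"
    unfolding percolation_def using J(1) by (intro cylinder_eq_prod_emb)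
  finally have S: "?S = \<dots>" .
  show "?S \<in> sets (percolation d k p q)"
    unfolding S unfolding percolation_def using J by (intro sets_PiM_I) auto
  have "measure (percolation d k p q) ?S =
      (\<Prod>e\<in>?J. measure (measure_pmf (bernoulli_pmf (edge_prob d p q e))) (?X e))"
    unfolding S unfolding percolation_def using J by (intro measure_PiM_emb) auto
  also have "\<dots> = (\<Prod>e\<in>?J. pmf (bernoulli_pmf (edge_prob d p q e)) (the (map_of cs e)))"
    by (simp add: measure_pmf_single)
  also have "\<dots> = prod_list (map (\<lambda>e. pmf (bernoulli_pmf (edge_prob d p q e)) (the (map_of cs e)))
      (map fst cs))"
    using prod.distinct_set_conv_list[OF assms(1)] by simp
  also have "\<dots> = prod_list (map (\<lambda>(e, x). pmf (bernoulli_pmf (edge_prob d p q e)) x) cs)"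
    by (auto intro!: arg_cong[where f = prod_list] simp: comp_def mo)
  finally show "measure (percolation d k p q) ?S = \<dots>" .
qed

section \<open>The expected number of paths without shortcuts\<close>

definition step_weight :: "real \<Rightarrow> real \<Rightarrow> vertex \<Rightarrow> real" where
  "step_weight p q s = (if length s = 1 then p else q)"

text \<open>The probability of the constraints of a block; see \<open>prod_list_block_constraints\<close>.\<close>

definition block_weight :: "real \<Rightarrow> real \<Rightarrow> vertex list \<Rightarrow> real" where
  "block_weight p q b =
     prod_list (map (step_weight p q) b) * (if \<forall>s\<in>set b. length s = 1 then 1 - q else 1)"

lemma sum_prod_list_lists:
  fixes g :: "'a \<Rightarrow> 'b :: comm_semiring_1"
  assumes "finite A"
  shows "(\<Sum>xs\<in>{xs. set xs \<subseteq> A \<and> length xs = n}. prod_list (map g xs)) = (\<Sum>x\<in>A. g x) ^ n"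
proof (induction n)
  case 0
  have "{xs. set xs \<subseteq> A \<and> length xs = 0} = {[]}" by auto
  then show ?case by simp
next
  case (Suc n)
  let ?L = "{xs. set xs \<subseteq> A \<and> length xs = n}"
  have "(\<Sum>xs\<in>{xs. set xs \<subseteq> A \<and> length xs = Suc n}. prod_list (map g xs)) =
      (\<Sum>(xs, x)\<in>?L \<times> A. g x * prod_list (map g xs))"
    unfolding lists_length_Suc_eq
    by (subst sum.reindex) (auto simp: inj_on_def case_prod_unfold)
  also have "\<dots> = (\<Sum>xs\<in>?L. prod_list (map g xs)) * (\<Sum>x\<in>A. g x)"
    by (simp add: sum.cartesian_product[symmetric] sum_product mult.commute) (rule sum.swap)
  finally show ?case using Suc by (simp add: mult.commute)
qed

lemma sum_words: "(\<And>v. length v = n \<Longrightarrow> f v = c) \<Longrightarrow> (\<Sum>v\<in>words d n. f v) = real d ^ n * c"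
proof -
  assume "\<And>v. length v = n \<Longrightarrow> f v = c"
  then have "(\<Sum>v\<in>words d n. f v) = (\<Sum>v\<in>words d n. c)"
    by (intro sum.cong) (auto simp: words_def)
  then show ?thesis by (simp add: card_words)
qed

text \<open>The term subtracted is the gain over the plain count of open paths: all-short blocks lose the
  fraction \<open>q\<close> of their weight \<open>(d p)\<^sup>k\<close>.\<close>

lemma sum_block_weight:
  assumes "k \<ge> 2"
  shows "(\<Sum>b\<in>blocks d k. block_weight p q b) =
    (real d * p + real d ^ k * q) ^ k - q * (real d * p) ^ k"
proof -
  let ?w = "\<lambda>b. prod_list (map (step_weight p q) b)"
  let ?S = "{b. set b \<subseteq> words d 1 \<and> length b = k}"
  have "words d 1 \<inter> words d k = {}"
    using assms by (auto simp: words_def)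
  then have steps: "(\<Sum>s\<in>steps d k. step_weight p q s) = real d * p + real d ^ k * q"
    using sum_words[of 1 "step_weight p q" p d] sum_words[of k "step_weight p q" q d] assms
    by (simp add: steps_def sum.union_disjoint step_weight_def)
  have sub: "?S \<subseteq> blocks d k" by (auto simp: blocks_def steps_def)
  have short: "(\<forall>s\<in>set b. length s = 1) \<longleftrightarrow> b \<in> ?S" if "b \<in> blocks d k" for b
    using that assms by (fastforce simp: blocks_def steps_def words_def)
  have "(\<Sum>b\<in>blocks d k. block_weight p q b) =
      (\<Sum>b\<in>blocks d k. ?w b - (if b \<in> ?S then q * ?w b else 0))"
    by (intro sum.cong refl) (simp only: block_weight_def short, simp add: algebra_simps)
  also have "\<dots> = (\<Sum>b\<in>blocks d k. ?w b) - (\<Sum>b\<in>?S. q * ?w b)"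
    unfolding sum_subtractf
    by (subst sum.inter_restrict[symmetric]) (use sub in \<open>auto simp: Int_absorb1\<close>)
  also have "(\<Sum>b\<in>?S. q * ?w b) = q * (real d * p) ^ k"
    using sum_prod_list_lists[of "words d 1" "step_weight p q" k]
      sum_words[of 1 "step_weight p q" p d]
    by (simp add: sum_distrib_left[symmetric] step_weight_def)
  also have "(\<Sum>b\<in>blocks d k. ?w b) = (real d * p + real d ^ k * q) ^ k"
    unfolding blocks_def by (subst sum_prod_list_lists) (simp_all add: steps)
  finally show ?thesis .
qed

lemma prod_list_path_edges:
  assumes "p \<in> {0..1}" "q \<in> {0..1}" "r \<in> vertices d" "set ss \<subseteq> steps d k"
  shows "prod_list (map (\<lambda>e. pmf (bernoulli_pmf (edge_prob d p q e)) True) (path_edges r ss)) =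
    prod_list (map (step_weight p q) ss)"
  using assms(3,4)
proof (induction ss arbitrary: r)
  case (Cons s ss)
  then have "edge_prob d p q (r, r @ s) = step_weight p q s"
    using short_edge_iff[of r d s k] by (simp add: step_weight_def)
  moreover have "step_weight p q s \<in> {0..1}" using assms by (simp add: step_weight_def)
  moreover have "r @ s \<in> vertices d" using Cons.prems append_step_in_vertices[of r d s k] by simp
  ultimately show ?case using Cons by (simp del: if_split_asm)
qed simp

text \<open>The bridge of an all-short block is not an edge of the block, as it is longer than each of them;
  hence it is independent of these edges.\<close>

lemma
  assumes "k \<ge> 2" "r \<in> vertices d" "b \<in> blocks d k"
  shows distinct_block_constraints: "distinct (map fst (block_constraints r b))"
    and block_constraints_in_edges: "fst ` set (block_constraints r b) \<subseteq> edges d k"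
    and prod_list_block_constraints: "p \<in> {0..1} \<Longrightarrow> q \<in> {0..1} \<Longrightarrow>
      prod_list (map (\<lambda>(e, x). pmf (bernoulli_pmf (edge_prob d p q e)) x) (block_constraints r b)) =
      block_weight p q b"
    and fst_block_constraints_bounds: "e \<in> fst ` set (block_constraints r b) \<Longrightarrow>
      length r \<le> length (fst e) \<and> length (fst e) < length r + length (concat b)"
proof -
  note ne = block_steps_nonempty[OF assms(3,1)]
  have b: "set b \<subseteq> steps d k" "length b = k" using assms(3) by (auto simp: blocks_def)
  let ?short = "\<forall>s\<in>set b. length s = 1"
  let ?e = "(r, r @ concat b)"
  have lc: "length (concat b) \<ge> 2"
  proof -
    have "length b \<le> length (concat b)"
      using b(1) length_step(1)[OF _ assms(1)] by (intro length_concat_ge) blast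
    with b(2) assms(1) show ?thesis by linarith
  qed
  have new: "?e \<notin> set (path_edges r b)" if ?short
  proof
    assume "?e \<in> set (path_edges r b)"
    from path_edges_step[OF this] that lc show False by auto
  qed
  have long: "concat b \<in> steps d k" if ?short
    using short_block_concat[OF assms(3) that] by (simp add: steps_def)
  have not_short: "?e \<notin> short_edges d"
    using lc by (auto simp: short_edges_def)
  have map_fst: "map fst (block_constraints r b) = path_edges r b @ (if ?short then [?e] else [])"
    by (simp add: block_constraints_def comp_def)
  have fsts: "fst ` set (block_constraints r b) =
      set (path_edges r b) \<union> (if ?short then {?e} else {})"
    unfolding set_map[symmetric] map_fst by auto
  show "distinct (map fst (block_constraints r b))"
    unfolding map_fst using distinct_path_edges[of b r] ne new by auto
  show "fst ` set (block_constraints r b) \<subseteq> edges d k"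
    unfolding fsts using path_edges_in_edges[OF assms(2) b(1)] step_edge_in_edges[OF assms(2) long]
    by auto
  show "length r \<le> length (fst e) \<and> length (fst e) < length r + length (concat b)"
    if "e \<in> fst ` set (block_constraints r b)"
  proof -
    from that consider "e \<in> set (path_edges r b)" | "e = ?e"
      unfolding fsts by (auto split: if_splits)
    then show ?thesis
    proof cases
      case 1
      then show ?thesis using fst_path_edges_bounds[of e r b] ne by blast
    next
      case 2
      have "0 < length (concat b)" using lc by linarith
      with 2 show ?thesis by (simp del: length_concat length_greater_0_conv)
    qed
  qed
  show "prod_list (map (\<lambda>(e, x). pmf (bernoulli_pmf (edge_prob d p q e)) x) (block_constraints r b)) =
      block_weight p q b" if pq: "p \<in> {0..1}" "q \<in> {0..1}"
    using prod_list_path_edges[OF pq assms(2) b(1)] not_short pq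
    by (simp add: block_constraints_def block_weight_def comp_def)
qed

text \<open>The edges constrained by the first block start at shorter words than those constrained by the
  later blocks, so the blocks do not interfere.\<close>

lemma
  assumes "k \<ge> 2" "r \<in> vertices d" "set bs \<subseteq> blocks d k"
  shows distinct_constraints: "distinct (map fst (constraints r bs))"
    and constraints_in_edges: "fst ` set (constraints r bs) \<subseteq> edges d k"
    and prod_list_constraints: "p \<in> {0..1} \<Longrightarrow> q \<in> {0..1} \<Longrightarrow>
      prod_list (map (\<lambda>(e, x). pmf (bernoulli_pmf (edge_prob d p q e)) x) (constraints r bs)) =
      prod_list (map (block_weight p q) bs)"
proof -
  have "distinct (map fst (constraints r bs)) \<and> fst ` set (constraints r bs) \<subseteq> edges d k \<and>
    (\<forall>e\<in>fst ` set (constraints r bs). length r \<le> length (fst e)) \<and>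
    (p \<in> {0..1} \<longrightarrow> q \<in> {0..1} \<longrightarrow>
      prod_list (map (\<lambda>(e, x). pmf (bernoulli_pmf (edge_prob d p q e)) x) (constraints r bs)) =
      prod_list (map (block_weight p q) bs))"
    using assms(2,3)
  proof (induction bs arbitrary: r)
    case (Cons b bs)
    have b: "b \<in> blocks d k" using Cons.prems by simp
    have "r @ concat b \<in> vertices d"
      using append_concat_in_vertices[OF Cons.prems(1), of b k] b by (simp add: blocks_def)
    note IH = Cons.IH[OF this]
    note block = distinct_block_constraints[OF assms(1) Cons.prems(1) b]
      block_constraints_in_edges[OF assms(1) Cons.prems(1) b]
      prod_list_block_constraints[OF assms(1) Cons.prems(1) b, of p q]
    note bounds = fst_block_constraints_bounds[OF assms(1) Cons.prems(1) b]
    have low: "\<forall>e\<in>fst ` set (constraints (r @ concat b) bs).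
        length r + length (concat b) \<le> length (fst e)"
      using IH Cons.prems by simp
    have "fst ` set (block_constraints r b) \<inter> fst ` set (constraints (r @ concat b) bs) = {}"
      using low bounds by (meson disjoint_iff linorder_not_less)
    then have "distinct (map fst (constraints r (b # bs)))"
      using IH Cons.prems(2) block(1) by simp
    moreover have "fst ` set (constraints r (b # bs)) \<subseteq> edges d k"
      using IH Cons.prems(2) block(2) by (simp add: image_Un)
    moreover have "\<forall>e\<in>fst ` set (constraints r (b # bs)). length r \<le> length (fst e)"
    proof
      fix e assume "e \<in> fst ` set (constraints r (b # bs))"
      then consider "e \<in> fst ` set (block_constraints r b)"
        | "e \<in> fst ` set (constraints (r @ concat b) bs)"
        by (auto simp: image_Un)
      then show "length r \<le> length (fst e)"
        by cases (use bounds low in \<open>blast intro: add_leD1\<close>)+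
    qed
    moreover have "p \<in> {0..1} \<longrightarrow> q \<in> {0..1} \<longrightarrow>
        prod_list (map (\<lambda>(e, x). pmf (bernoulli_pmf (edge_prob d p q e)) x)
          (constraints r (b # bs))) = prod_list (map (block_weight p q) (b # bs))"
    proof (intro impI)
      assume pq: "p \<in> {0..1}" "q \<in> {0..1}"
      with IH Cons.prems(2) show "prod_list (map (\<lambda>(e, x). pmf (bernoulli_pmf (edge_prob d p q e)) x)
          (constraints r (b # bs))) = prod_list (map (block_weight p q) (b # bs))"
        by (simp add: block(3)[OF pq])
    qed
    ultimately show ?case by blast
  qed simp
  then show "distinct (map fst (constraints r bs))" "fst ` set (constraints r bs) \<subseteq> edges d k"
    "p \<in> {0..1} \<Longrightarrow> q \<in> {0..1} \<Longrightarrow>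
      prod_list (map (\<lambda>(e, x). pmf (bernoulli_pmf (edge_prob d p q e)) x) (constraints r bs)) =
      prod_list (map (block_weight p q) bs)" by blast+
qed

text \<open>A union bound over all sequences of \<open>j\<close> blocks. The sum over sequences of a product of block
  weights factors into the \<open>j\<close>-th power of the sum over a single block.\<close>

lemma prob_infinite_cluster_le:
  assumes "k \<ge> 2" "p \<in> {0..1}" "q \<in> {0..1}"
  shows "\<P>(\<omega> in percolation d k p q. infinite (root_cluster d k \<omega>)) \<le>
    ((real d * p + real d ^ k * q) ^ k - q * (real d * p) ^ k) ^ j"
proof -
  let ?M = "percolation d k p q"
  let ?B = "{bs. set bs \<subseteq> blocks d k \<and> length bs = j}"
  let ?E = "\<lambda>bs. {\<omega> \<in> space ?M. \<forall>(e, x)\<in>set (constraints [] bs). \<omega> e = x}"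
  interpret prob_space ?M by (rule prob_space_percolation)
  have root: "[] \<in> vertices d" by (simp add: in_vertices_iff)
  have fin: "finite ?B" by (rule finite_lists_length_eq) simp
  have E: "?E bs \<in> sets ?M" if "bs \<in> ?B" for bs
  proof -
    from that have bs: "set bs \<subseteq> blocks d k" by simp
    show ?thesis
      using distinct_constraints[OF assms(1) root bs] constraints_in_edges[OF assms(1) root bs]
      by (rule cylinder_in_sets)
  qed
  have "\<P>(\<omega> in ?M. infinite (root_cluster d k \<omega>)) \<le> prob (\<Union>bs\<in>?B. ?E bs)"
  proof (rule finite_measure_mono)
    show "{\<omega> \<in> space ?M. infinite (root_cluster d k \<omega>)} \<subseteq> (\<Union>bs\<in>?B. ?E bs)"
    proof
      fix \<omega> assume "\<omega> \<in> {\<omega> \<in> space ?M. infinite (root_cluster d k \<omega>)}"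
      then have "\<omega> \<in> space ?M" "infinite (root_cluster d k \<omega>)" by simp_all
      with infinite_cluster_constraints[OF assms(1) this(2), of j]
      show "\<omega> \<in> (\<Union>bs\<in>?B. ?E bs)" by blast
    qed
    show "(\<Union>bs\<in>?B. ?E bs) \<in> sets ?M" using fin E by (rule sets.finite_UN)
  qed
  also have "\<dots> \<le> (\<Sum>bs\<in>?B. prob (?E bs))"
    using fin by (rule finite_measure_subadditive_finite) (use E in blast)
  also have "\<dots> = (\<Sum>bs\<in>?B. prod_list (map (block_weight p q) bs))"
  proof (rule sum.cong[OF refl])
    fix bs assume "bs \<in> ?B"
    then have bs: "set bs \<subseteq> blocks d k" by simp
    show "prob (?E bs) = prod_list (map (block_weight p q) bs)"
      using measure_cylinder[OF distinct_constraints[OF assms(1) root bs]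
          constraints_in_edges[OF assms(1) root bs], of p q]
        prod_list_constraints[OF assms(1) root bs assms(2,3)] by simp
  qed
  also have "\<dots> = ((real d * p + real d ^ k * q) ^ k - q * (real d * p) ^ k) ^ j"
    by (simp add: sum_prod_list_lists sum_block_weight[OF assms(1)])
  finally show ?thesis .
qed

lemma prob_infinite_cluster_eq_0:
  assumes "k \<ge> 2" "p \<in> {0..1}" "q \<in> {0..1}"
    and "(real d * p + real d ^ k * q) ^ k - q * (real d * p) ^ k < 1"
  shows "\<P>(\<omega> in percolation d k p q. infinite (root_cluster d k \<omega>)) = 0"
proof -
  let ?f = "(real d * p + real d ^ k * q) ^ k - q * (real d * p) ^ k"
  have "q * (real d * p) ^ k \<le> 1 * (real d * p) ^ k"
    using assms by (intro mult_right_mono) auto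
  also have "\<dots> \<le> (real d * p + real d ^ k * q) ^ k"
    using assms by (auto intro!: power_mono)
  finally have "0 \<le> ?f" by simp
  then have "(\<lambda>j. ?f ^ j) \<longlonglongrightarrow> 0"
    using assms(4) by (intro LIMSEQ_realpow_zero)
  then have "\<P>(\<omega> in percolation d k p q. infinite (root_cluster d k \<omega>)) \<le> 0"
    by (rule LIMSEQ_le_const) (use prob_infinite_cluster_le[OF assms(1-3)] in blast)
  then show ?thesis by (simp add: measure_le_0_iff)
qed

section \<open>Percolation at \<open>q = 1\<close>\<close>

text \<open>The ray of long edges that always append the word \<open>1\<dots>1\<close> is almost surely open.\<close>

lemma prob_infinite_cluster_1:
  assumes "d \<ge> 1" "k \<ge> 2"
  shows "\<P>(\<omega> in percolation d k p 1. infinite (root_cluster d k \<omega>)) = 1"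
proof -
  let ?M = "percolation d k p 1"
  interpret prob_space ?M by (rule prob_space_percolation)
  define s where "s = replicate k (1 :: nat)"
  have s: "s \<in> steps d k" "length s = k"
    using assms by (auto simp: s_def steps_def words_def)
  have root: "[] \<in> vertices d" by (simp add: in_vertices_iff)
  let ?cs = "\<lambda>ss. map (\<lambda>e. (e, True)) (path_edges [] ss)"
  let ?P = "\<lambda>ss. {\<omega> \<in> space ?M. \<forall>e\<in>set (path_edges [] ss). \<omega> e}"
  have P_eq: "?P ss = {\<omega> \<in> space ?M. \<forall>(e, x)\<in>set (?cs ss). \<omega> e = x}" for ss
    by auto
  have ok: "distinct (map fst (?cs ss))" "fst ` set (?cs ss) \<subseteq> edges d k"
    if "set ss \<subseteq> steps d k" for ss
  proof -
    have "\<forall>s\<in>set ss. s \<noteq> []" using that length_step(1)[OF _ assms(2)] by fastforce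
    then show "distinct (map fst (?cs ss))" by (simp add: comp_def distinct_path_edges)
    show "fst ` set (?cs ss) \<subseteq> edges d k"
      using path_edges_in_edges[OF root that] by (simp add: image_image)
  qed
  have meas: "?P ss \<in> sets ?M" if "set ss \<subseteq> steps d k" for ss
    unfolding P_eq by (intro cylinder_in_sets ok that)
  have AE: "AE \<omega> in ?M. \<forall>e\<in>set (path_edges [] (replicate n s)). \<omega> e" for n
  proof -
    have sub: "set (replicate n s) \<subseteq> steps d k" using s by auto
    have "edge_prob d p 1 e = 1" if "e \<in> set (path_edges r (replicate n s))" for e r
    proof -
      obtain u v where "e = (u, v)" by fastforce
      with path_edges_step[of u v r "replicate n s"] that have "e = (u, u @ s)" by auto
      then have "e \<notin> short_edges d" using s(2) assms(2) by (auto simp: short_edges_def)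
      then show ?thesis by simp
    qed
    then have "map (\<lambda>(e, x). pmf (bernoulli_pmf (edge_prob d p 1 e)) x) (?cs (replicate n s)) =
        map (\<lambda>_. 1) (path_edges [] (replicate n s))"
      by (simp cong: if_cong)
    then have "prob (?P (replicate n s)) = 1"
      unfolding P_eq measure_cylinder[OF ok[OF sub]] by (simp add: map_replicate_const)
    then show ?thesis
      using prob_Collect_eq_1[OF meas[OF sub]] by simp
  qed
  then have "AE \<omega> in ?M. \<forall>n. \<forall>e\<in>set (path_edges [] (replicate n s)). \<omega> e"
    unfolding AE_all_countable by blast
  moreover have "infinite (root_cluster d k \<omega>)"
    if "\<forall>n. \<forall>e\<in>set (path_edges [] (replicate n s)). \<omega> e" for \<omega>
    unfolding infinite_cluster_iff[OF assms(2)]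
  proof
    fix n
    show "\<exists>ss\<in>{ss. set ss \<subseteq> steps d k \<and> length ss = n}. \<forall>e\<in>set (path_edges [] ss). \<omega> e"
      by (rule bexI[of _ "replicate n s"]) (use that s(1) in auto)
  qed
  ultimately have "AE \<omega> in ?M. infinite (root_cluster d k \<omega>)"
    by (rule eventually_mono)
  moreover have "{\<omega> \<in> space ?M. infinite (root_cluster d k \<omega>)} \<in> sets ?M"
  proof -
    have fin: "finite {ss. set ss \<subseteq> steps d k \<and> length ss = n}" for n
      by (rule finite_lists_length_eq) simp
    show ?thesis
      unfolding infinite_cluster_iff[OF assms(2)]
      by (intro sets.sets_Collect_countable_All sets.sets_Collect_finite_Ex fin meas) auto
  qed
  ultimately show ?thesis by (simp add: prob_Collect_eq_1)
qed

theorem theorem1p1: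
  fixes d k :: nat and p :: real
  assumes "d \<ge> 2" and "k \<ge> 2" and "p \<in> {0<..<1 / real d}"
  shows "critical_q d k p > (1 - real d * p) / real d ^ k"
proof -
  define q0 where "q0 = (1 - real d * p) / real d ^ k"
  define f where "f q = (real d * p + real d ^ k * q) ^ k - q * (real d * p) ^ k" for q
  have dp: "0 < real d * p" "real d * p < 1"
    using assms by (auto simp: field_simps)
  have p: "p \<in> {0..1}"
  proof -
    have "1 / real d \<le> 1" using assms(1) by simp
    then show ?thesis using assms(3) by auto
  qed
  have dk: "0 < real d ^ k" using assms(1) by simp
  have q0: "0 < q0" "real d * p + real d ^ k * q0 = 1"
    using dp dk by (auto simp: q0_def)
  have "f q0 < 1" using q0 dp by (simp add: f_def)
  moreover have "isCont f q0" unfolding f_def by (intro continuous_intros)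
  ultimately have "\<forall>\<^sub>F q in at q0. f q < 1"
    by (intro order_tendstoD(2)[of f "f q0"]) (simp_all add: isCont_def)
  then obtain \<delta> where \<delta>: "\<delta> > 0" "\<And>q. q \<noteq> q0 \<Longrightarrow> dist q q0 < \<delta> \<Longrightarrow> f q < 1"
    by (auto simp: eventually_at)
  \<comment> \<open>Below \<open>q0\<close> the plain count of open paths suffices; the correction is needed from \<open>q0\<close> on.\<close>
  have f_less: "f q < 1" if "0 \<le> q" "q < q0 + \<delta>" for q
  proof (cases "q < q0")
    case True
    have "real d * p + real d ^ k * q < real d * p + real d ^ k * q0"
      using True dk by simp
    then have "(real d * p + real d ^ k * q) ^ k < 1"
      using dp dk that(1) assms(2) unfolding q0(2)
      by (intro power_less_one_iff[THEN iffD2]) auto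
    moreover have "0 \<le> q * (real d * p) ^ k" using dp that by simp
    ultimately show ?thesis by (simp add: f_def)
  next
    case False
    then show ?thesis using \<delta>(2)[of q] \<open>f q0 < 1\<close> that by (cases "q = q0") (auto simp: dist_real_def)
  qed
  let ?Q = "{q \<in> {0..1}. \<P>(\<omega> in percolation d k p q. infinite (root_cluster d k \<omega>)) > 0}"
  have "1 \<in> ?Q" using prob_infinite_cluster_1[of d k p] assms by simp
  then have "?Q \<noteq> {}" by blast
  moreover have "q0 + \<delta> \<le> q" if "q \<in> ?Q" for q
  proof (rule ccontr)
    assume "\<not> q0 + \<delta> \<le> q"
    with that have "f q < 1" by (intro f_less) auto
    with prob_infinite_cluster_eq_0[OF assms(2) p, of q d] that show False
      by (simp add: f_def)
  qed
  ultimately have "q0 + \<delta> \<le> Inf ?Q" by (rule cInf_greatest)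
  then show ?thesis using \<delta>(1) by (simp add: critical_q_def q0_def)
qed

end
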